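(* Let $R$ be an integral domain and let $(K,w)$ be a weighted simplicial complex with $K$ finite and $w:K\to R$. Let $n\ge 1$ and let $\sigma^{(n-1)}<\tau^{(n)}$ be simplices of $K$ such that $\sigma$ is a free face of $\tau$ in $K$, so that $K$ collapses onto $L=K\setminus\{\sigma,\tau\}$ by an elementary collapse of dimension $n$. Suppose that $w(\sigma)=w(\tau)=a$ for some $a\in R\setminus\{0\}$. Then the collapse $K\searrow L$ preserves weighted homology, i.e. $H_i(K,w)\cong H_i(L,w)$ for all $i\ge 0$.
   Context: $R$ is an integral domain (commutative, with unity). Simplicial complexes are finite abstract simplicial complexes (simplices are nonempty finite sets of vertices); $\sigma^{(n)}$ indicates that $\dim\sigma=n$, and $\sigma<\tau$ means $\sigma\subsetneq\tau$. A weighted simplicial complex (WSC) is a pair $(K,w)$ of a simplicial complex $K$ and a function $w:K\to R$ such that $\sigma_1\subseteq\sigma_2$ implies $w(\sigma_1)\mid w(\sigma_2)$ in $R$. $C_n(K,w)$ is the free $R$-module with basis the $n$-simplices of $K$ with nonzero weight ($C_{-1}=0$). Fixing a total order on the vertices, the weighted boundary map $\partial_n^w:C_n(K,w)\to C_{n-1}(K,w)$ is the $R$-linear map with $\partial_n^w(\sigma)=\sum_{i=0}^n\frac{w(\sigma)}{w(d_i\sigma)}(-1)^i d_i\sigma$, where $d_i[v_0,\dots,v_n]=[v_0,\dots,\widehat{v_i},\dots,v_n]$. The weighted homology is the $R$-module $H_n(K,w)=\ker(\partial_n^w)/\operatorname{Im}(\partial_{n+1}^w)$. For a subcomplex $L\subseteq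 K$, $(L,w)$ means $(L,w|_L)$. If $\sigma<\tau$ and $\sigma$ is not a proper face of any simplex of $K$ other than $\tau$, then $\sigma$ is called a free face of $\tau$ (in $K$); then necessarily $\dim\tau=\dim\sigma+1$ and $\tau$ is a maximal simplex of $K$. In this situation, with $\dim \tau=n$, $K$ is said to collapse onto $L=K\setminus\{\sigma,\tau\}$ by an elementary collapse of dimension $n$. *)

theory Defs
  imports "HOL-Algebra.Algebra"
begin

section \<open>Free modules, quotient modules, isomorphism of modules\<close>

text \<open>A module in HOL-Algebra is a record extending the ring record. Its fields \<open>mult\<close> and
  \<open>one\<close> play no role for modules and are left \<open>undefined\<close>.\<close>

definition free_module :: "('r, 'm) ring_scheme \<Rightarrow> 'b set \<Rightarrow> ('r, 'b \<Rightarrow> 'r) module" where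
  "free_module R B =
     \<lparr>carrier = {c. (\<forall>b. c b \<in> carrier R) \<and> (\<forall>b. b \<notin> B \<longrightarrow> c b = \<zero>\<^bsub>R\<^esub>)
                   \<and> finite {b. c b \<noteq> \<zero>\<^bsub>R\<^esub>}},
      monoid.mult = undefined, one = undefined,
      ring.zero = (\<lambda>b. \<zero>\<^bsub>R\<^esub>),
      ring.add = (\<lambda>c d b. c b \<oplus>\<^bsub>R\<^esub> d b),
      smult = (\<lambda>r c b. r \<otimes>\<^bsub>R\<^esub> c b)\<rparr>"

definition basis_vector :: "('r, 'm) ring_scheme \<Rightarrow> 'b \<Rightarrow> 'b \<Rightarrow> 'r" where
  "basis_vector R b = (\<lambda>b'. if b' = b then \<one>\<^bsub>R\<^esub> else \<zero>\<^bsub>R\<^esub>)"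

text \<open>The scalar action is \<open>r (N + x) = N + r x\<close>; the union runs over all representatives,
  which give the same coset when \<open>N\<close> is a submodule.\<close>

definition quotient_module ::
  "('r, 'a, 'm) module_scheme \<Rightarrow> 'a set \<Rightarrow> ('r, 'a set) module" where
  "quotient_module M N =
     \<lparr>carrier = a_rcosets\<^bsub>M\<^esub> N,
      monoid.mult = undefined, one = undefined,
      ring.zero = N,
      ring.add = (\<lambda>C D. C <+>\<^bsub>M\<^esub> D),
      smult = (\<lambda>r C. \<Union>x\<in>C. N +>\<^bsub>M\<^esub> (r \<odot>\<^bsub>M\<^esub> x))\<rparr>"

definition module_isomorphic ::
  "('r, 'm) ring_scheme \<Rightarrow> ('r, 'a, 'p) module_scheme \<Rightarrow> ('r, 'b, 'q) module_scheme \<Rightarrow> bool" where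
  "module_isomorphic R M N \<longleftrightarrow>
     (\<exists>h \<in> iso (add_monoid M) (add_monoid N).
        \<forall>r\<in>carrier R. \<forall>x\<in>carrier M. h (r \<odot>\<^bsub>M\<^esub> x) = r \<odot>\<^bsub>N\<^esub> h x)"


section \<open>Weighted simplicial complexes\<close>

definition abstract_simplicial_complex :: "'v set set \<Rightarrow> bool" where
  "abstract_simplicial_complex K \<longleftrightarrow>
     finite K \<and> (\<forall>\<sigma>\<in>K. finite \<sigma> \<and> \<sigma> \<noteq> {}) \<and>
     (\<forall>\<sigma>\<in>K. \<forall>\<rho>. \<rho> \<subseteq> \<sigma> \<and> \<rho> \<noteq> {} \<longrightarrow> \<rho> \<in> K)"

definition simplex_dim :: "'v set \<Rightarrow> int" where
  "simplex_dim \<sigma> = int (card \<sigma>) - 1"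

definition weighted_simplicial_complex ::
  "('r, 'm) ring_scheme \<Rightarrow> 'v set set \<Rightarrow> ('v set \<Rightarrow> 'r) \<Rightarrow> bool" where
  "weighted_simplicial_complex R K w \<longleftrightarrow>
     abstract_simplicial_complex K \<and> w \<in> K \<rightarrow> carrier R \<and>
     (\<forall>\<sigma>\<^sub>1\<in>K. \<forall>\<sigma>\<^sub>2\<in>K. \<sigma>\<^sub>1 \<subseteq> \<sigma>\<^sub>2 \<longrightarrow> w \<sigma>\<^sub>1 divides\<^bsub>R\<^esub> w \<sigma>\<^sub>2)"

definition free_face :: "'v set set \<Rightarrow> 'v set \<Rightarrow> 'v set \<Rightarrow> bool" where
  "free_face K \<sigma> \<tau> \<longleftrightarrow>
     \<sigma> \<in> K \<and> \<tau> \<in> K \<and> \<sigma> \<subset> \<tau> \<and> (\<forall>\<rho>\<in>K. \<sigma> \<subset> \<rho> \<longrightarrow> \<rho> = \<tau>)"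


section \<open>Weighted homology\<close>

definition weighted_simplices ::
  "('r, 'm) ring_scheme \<Rightarrow> 'v set set \<Rightarrow> ('v set \<Rightarrow> 'r) \<Rightarrow> int \<Rightarrow> 'v set set" where
  "weighted_simplices R K w n = {\<sigma>\<in>K. simplex_dim \<sigma> = n \<and> w \<sigma> \<noteq> \<zero>\<^bsub>R\<^esub>}"

text \<open>Degrees are integers; as simplices are nonempty, the chain module of degree \<open>-1\<close> is free
  on the empty set, hence zero.\<close>

definition weighted_chains ::
  "('r, 'm) ring_scheme \<Rightarrow> 'v set set \<Rightarrow> ('v set \<Rightarrow> 'r) \<Rightarrow> int \<Rightarrow> ('r, 'v set \<Rightarrow> 'r) module" where
  "weighted_chains R K w n = free_module R (weighted_simplices R K w n)"

text \<open>\<open>d\<^sub>i\<close> deletes the \<open>i\<close>-th vertex (counted from 0) in the order of the type \<open>'v\<close>.\<close>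

definition face :: "nat \<Rightarrow> 'v::linorder set \<Rightarrow> 'v set" where
  "face i \<sigma> = \<sigma> - {sorted_list_of_set \<sigma> ! i}"

text \<open>The fraction \<open>x / y\<close> for \<open>y\<close> a nonzero divisor of \<open>x\<close>; the quotient is unique in a domain.\<close>

definition exact_quotient :: "('r, 'm) ring_scheme \<Rightarrow> 'r \<Rightarrow> 'r \<Rightarrow> 'r" where
  "exact_quotient R x y = (THE q. q \<in> carrier R \<and> x = y \<otimes>\<^bsub>R\<^esub> q)"

text \<open>The boundary of a basis element of degree \<open>n \<ge> 1\<close>. If \<open>w \<sigma> \<noteq> 0\<close>, then the weights of
  the faces are nonzero as well, because they divide \<open>w \<sigma>\<close>.\<close>

definition simplex_boundary ::
  "('r, 'm) ring_scheme \<Rightarrow> 'v::linorder set set \<Rightarrow> ('v set \<Rightarrow> 'r) \<Rightarrow> int \<Rightarrow> 'v set \<Rightarrow> 'v set \<Rightarrow> 'r"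
  where
  "simplex_boundary R K w n \<sigma> =
     (\<Oplus>\<^bsub>weighted_chains R K w (n - 1)\<^esub> i \<in> {0..nat n}.
        (exact_quotient R (w \<sigma>) (w (face i \<sigma>)) \<otimes>\<^bsub>R\<^esub> (\<ominus>\<^bsub>R\<^esub> \<one>\<^bsub>R\<^esub>) [^]\<^bsub>R\<^esub> i)
          \<odot>\<^bsub>weighted_chains R K w (n - 1)\<^esub> basis_vector R (face i \<sigma>))"

text \<open>Linear extension. Degrees \<open>n \<le> 0\<close> are treated separately since the target is then zero,
  and the face of a vertex is the empty set, which is not a simplex.\<close>

definition weighted_boundary ::
  "('r, 'm) ring_scheme \<Rightarrow> 'v::linorder set set \<Rightarrow> ('v set \<Rightarrow> 'r) \<Rightarrow> int
     \<Rightarrow> ('v set \<Rightarrow> 'r) \<Rightarrow> ('v set \<Rightarrow> 'r)" where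
  "weighted_boundary R K w n c =
     (if n \<le> 0 then \<zero>\<^bsub>weighted_chains R K w (n - 1)\<^esub>
      else \<Oplus>\<^bsub>weighted_chains R K w (n - 1)\<^esub> \<sigma> \<in> weighted_simplices R K w n.
             c \<sigma> \<odot>\<^bsub>weighted_chains R K w (n - 1)\<^esub> simplex_boundary R K w n \<sigma>)"

definition weighted_cycles ::
  "('r, 'm) ring_scheme \<Rightarrow> 'v::linorder set set \<Rightarrow> ('v set \<Rightarrow> 'r) \<Rightarrow> int \<Rightarrow> ('v set \<Rightarrow> 'r) set" where
  "weighted_cycles R K w n =
     a_kernel (weighted_chains R K w n) (weighted_chains R K w (n - 1)) (weighted_boundary R K w n)"

definition weighted_boundaries ::
  "('r, 'm) ring_scheme \<Rightarrow> 'v::linorder set set \<Rightarrow> ('v set \<Rightarrow> 'r) \<Rightarrow> int \<Rightarrow> ('v set \<Rightarrow> 'r) set" where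
  "weighted_boundaries R K w n =
     weighted_boundary R K w (n + 1) ` carrier (weighted_chains R K w (n + 1))"

definition weighted_homology ::
  "('r, 'm) ring_scheme \<Rightarrow> 'v::linorder set set \<Rightarrow> ('v set \<Rightarrow> 'r) \<Rightarrow> int
     \<Rightarrow> ('r, ('v set \<Rightarrow> 'r) set) module" where
  "weighted_homology R K w n =
     quotient_module ((weighted_chains R K w n)\<lparr>carrier := weighted_cycles R K w n\<rparr>)
       (weighted_boundaries R K w n)"

end

theory Submission
  imports Defs
begin

text \<open>Since \<open>w \<sigma> = w \<tau> \<noteq> 0\<close>, the coefficient of \<open>\<sigma>\<close> in \<open>\<partial>\<tau>\<close> is a sign \<open>\<epsilon>\<close>, and because \<open>\<sigma>\<close> is free it
  occurs in no other boundary. So an \<open>n\<close>-chain whose boundary vanishes at \<open>\<sigma>\<close> lies in \<open>L\<close>, and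
  modulo the boundary \<open>\<partial>\<tau>\<close> every \<open>(n - 1)\<close>-chain lies in \<open>L\<close>. With \<open>\<partial>\<partial> = 0\<close> this yields
  \<open>Z(K) = Z(L) + B(K)\<close> and \<open>B(L) = Z(L) \<inter> B(K)\<close> in all degrees, and the second isomorphism
  theorem identifies the homology modules.\<close>

section \<open>Modules\<close>

text \<open>Only degrees \<open>n - 1\<close> and \<open>n\<close> distinguish the chains of
  \<open>L\<close> from those of \<open>K\<close>, so the two equations need an argument only where
  cycles, or the chains that bound them, live in one of these degrees. The equality of the two
  weights matters because the coefficient of the free face must be inverted twice: to conclude that
  a coefficient at \<tau> vanishes, and to choose the multiple of the boundary of \<tau> that
  cancels a given coefficient at the free face. For unequal weights it would be a sign times a
  quotient of weights, which need not be a unit. No retraction of chain complexes is built. Chains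
  are functions on all vertex sets, extended by zero, so chains of \<open>L\<close> literally are
  chains of \<open>K\<close>, and both homologies become subquotients of one module. The boundary is
  given by positions in a sorted vertex list and by a description operator for quotients. Everything
  is therefore reduced to a matrix of incidence numbers, whose entries depend only on the weight and
  the two simplices, not on the complex or the degree. Comparing \<open>K\<close> with
  \<open>L\<close>, isolating the free face and squaring the boundary are then statements about
  matrix entries.\<close>

lemma (in module) submodule_of_lin_closed:
  assumes "H \<subseteq> carrier M" and "\<zero>\<^bsub>M\<^esub> \<in> H"
    and "\<And>x y. \<lbrakk>x \<in> H; y \<in> H\<rbrakk> \<Longrightarrow> x \<oplus>\<^bsub>M\<^esub> y \<in> H"
    and "\<And>r x. \<lbrakk>r \<in> carrier R; x \<in> H\<rbrakk> \<Longrightarrow> r \<odot>\<^bsub>M\<^esub> x \<in> H"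
  shows "submodule H R M"
proof (rule submoduleI)
  fix x assume x: "x \<in> H"
  then have "\<ominus>\<^bsub>M\<^esub> x = (\<ominus> \<one>) \<odot>\<^bsub>M\<^esub> x"
    using assms(1) by (simp add: smult_l_minus subset_iff)
  then show "\<ominus>\<^bsub>M\<^esub> x \<in> H" using assms(4)[of "\<ominus> \<one>" x] x by simp
qed (use assms in auto)

text \<open>Two representatives differ by some \<open>b\<close> in \<open>B\<close>, and
  \<open>r\<close> times \<open>b\<close> is again in \<open>B\<close>; hence all cosets in the
  union that defines the scalar action of \<open>quotient_module\<close> coincide.\<close>

lemma (in module) coset_smult:
  assumes B: "submodule B R M" and x: "x \<in> carrier M" and r: "r \<in> carrier R"
  shows "(\<Union>y\<in>B +>\<^bsub>M\<^esub> x. B +>\<^bsub>M\<^esub> (r \<odot>\<^bsub>M\<^esub> y)) = B +>\<^bsub>M\<^esub> (r \<odot>\<^bsub>M\<^esub> x)"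
proof -
  interpret B: submodule B R M by (rule B)
  have sub: "subgroup B (add_monoid M)" by (rule B.subgroup_axioms)
  have BM: "B \<subseteq> carrier M" using submoduleE(1)[OF B] .
  have "B +>\<^bsub>M\<^esub> (r \<odot>\<^bsub>M\<^esub> y) = B +>\<^bsub>M\<^esub> (r \<odot>\<^bsub>M\<^esub> x)" if "y \<in> B +>\<^bsub>M\<^esub> x" for y
  proof -
    from that obtain b where b: "b \<in> B" "y = b \<oplus>\<^bsub>M\<^esub> x" by (auto simp: a_r_coset_def')
    have "r \<odot>\<^bsub>M\<^esub> y = r \<odot>\<^bsub>M\<^esub> b \<oplus>\<^bsub>M\<^esub> r \<odot>\<^bsub>M\<^esub> x"
      using smult_r_distr[OF r] subsetD[OF BM b(1)] x b(2) by simp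
    moreover have "r \<odot>\<^bsub>M\<^esub> b \<in> B" using b r by simp
    ultimately have "r \<odot>\<^bsub>M\<^esub> y \<in> B +>\<^bsub>M\<^esub> (r \<odot>\<^bsub>M\<^esub> x)"
      by (auto simp: a_r_coset_def')
    then show ?thesis using M.a_repr_independence sub x r by simp
  qed
  moreover have "x \<in> B +>\<^bsub>M\<^esub> x"
  proof -
    have "\<zero>\<^bsub>M\<^esub> \<oplus>\<^bsub>M\<^esub> x \<in> B +>\<^bsub>M\<^esub> x"
      using subgroup.one_closed[OF sub] by (auto simp: a_r_coset_def')
    then show ?thesis using x by simp
  qed
  ultimately show ?thesis by blast
qed

lemma (in module) coset_add:
  assumes B: "submodule B R M" and "x \<in> carrier M" "y \<in> carrier M"
  shows "(B +>\<^bsub>M\<^esub> x) <+>\<^bsub>M\<^esub> (B +>\<^bsub>M\<^esub> y) = B +>\<^bsub>M\<^esub> (x \<oplus>\<^bsub>M\<^esub> y)"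
proof -
  have "abelian_subgroup B M"
    by (intro abelian_subgroupI3 additive_subgroupI submodule.axioms(1)[OF B] M.abelian_group_axioms)
  then show ?thesis using abelian_subgroup.a_rcos_sum assms(2,3) by metis
qed

text \<open>The second isomorphism theorem, \<open>(B + Z') / B \<cong> Z' / (Z' \<inter> B)\<close>: a coset of \<open>B\<close> is sent
  to its intersection with \<open>Z'\<close>.\<close>

lemma (in module) quotient_module_isomorphic_Int:
  assumes B: "submodule B R M" and Z': "submodule Z' R M"
    and sub: "Z' \<subseteq> Z"
    and cover: "\<And>z. z \<in> Z \<Longrightarrow> \<exists>b\<in>B. \<exists>z'\<in>Z'. z = b \<oplus>\<^bsub>M\<^esub> z'"
  shows "module_isomorphic R (quotient_module (M\<lparr>carrier := Z\<rparr>) B)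
           (quotient_module (M\<lparr>carrier := Z'\<rparr>) (Z' \<inter> B))"
proof -
  have BM: "B \<subseteq> carrier M" and ZM: "Z' \<subseteq> carrier M"
    using submoduleE(1) B Z' by auto
  have sgB: "subgroup B (add_monoid M)" and sgZ: "subgroup Z' (add_monoid M)"
    using B Z' by (auto simp: submodule_def)
  have Zdiff: "x \<oplus>\<^bsub>M\<^esub> \<ominus>\<^bsub>M\<^esub> y \<in> Z'" if "x \<in> Z'" "y \<in> Z'" for x y
    using that submoduleE(3,5)[OF Z'] by simp
  have I: "submodule (Z' \<inter> B) R M"
  proof (rule submodule_of_lin_closed)
    show "\<zero>\<^bsub>M\<^esub> \<in> Z' \<inter> B"
      using subgroup.one_closed[OF sgB] subgroup.one_closed[OF sgZ] by simp
  qed (use BM submoduleE[OF B] submoduleE[OF Z'] in auto)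
  define h where "h = (\<lambda>C. C \<inter> Z')"
  have h_coset: "h (B +>\<^bsub>M\<^esub> z) = (Z' \<inter> B) +>\<^bsub>M\<^esub> z" if z: "z \<in> Z'" for z
  proof (intro equalityI subsetI)
    fix x assume "x \<in> h (B +>\<^bsub>M\<^esub> z)"
    then obtain b where b: "b \<in> B" "x = b \<oplus>\<^bsub>M\<^esub> z" "x \<in> Z'"
      by (auto simp: h_def a_r_coset_def')
    \<comment> \<open>As a difference of two elements of \<open>Z'\<close>, the translating element
      \<open>b\<close> lies in \<open>Z'\<close> too.\<close>
    have "b = x \<oplus>\<^bsub>M\<^esub> \<ominus>\<^bsub>M\<^esub> z" using subsetD[OF BM b(1)] subsetD[OF ZM z] b(2)
      by (simp add: M.a_assoc M.r_neg)
    then have "b \<in> Z'" using Zdiff[OF b(3) z] by simp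
    then show "x \<in> (Z' \<inter> B) +>\<^bsub>M\<^esub> z" using b by (auto simp: a_r_coset_def')
  next
    fix x assume "x \<in> (Z' \<inter> B) +>\<^bsub>M\<^esub> z"
    then show "x \<in> h (B +>\<^bsub>M\<^esub> z)"
      using z submoduleE(5)[OF Z'] by (auto simp: h_def a_r_coset_def')
  qed
  have cosets: "a_rcosets\<^bsub>M\<lparr>carrier := Z\<rparr>\<^esub> B = (\<lambda>z. B +>\<^bsub>M\<^esub> z) ` Z'"
  proof -
    have "B +>\<^bsub>M\<^esub> z \<in> (\<lambda>z. B +>\<^bsub>M\<^esub> z) ` Z'" if z: "z \<in> Z" for z
    proof -
      obtain b z' where bz: "b \<in> B" "z' \<in> Z'" "z = b \<oplus>\<^bsub>M\<^esub> z'"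
        using cover[OF z] by blast
      then have "z \<in> B +>\<^bsub>M\<^esub> z'" by (auto simp: a_r_coset_def')
      then have "B +>\<^bsub>M\<^esub> z' = B +>\<^bsub>M\<^esub> z"
        using M.a_repr_independence bz ZM sgB by blast
      then show ?thesis using bz by blast
    qed
    then show ?thesis using sub by (auto simp: A_RCOSETS_def' a_r_coset_def')
  qed
  have cosets': "a_rcosets\<^bsub>M\<lparr>carrier := Z'\<rparr>\<^esub> (Z' \<inter> B) = (\<lambda>z. (Z' \<inter> B) +>\<^bsub>M\<^esub> z) ` Z'"
    by (auto simp: A_RCOSETS_def' a_r_coset_def')
  \<comment> \<open>Cosets and their sums are formed without looking at the carrier, so both
    quotients can be computed inside \<open>M\<close>.\<close>
  have coset_upd: "C +>\<^bsub>M\<lparr>carrier := Y\<rparr>\<^esub> x = C +>\<^bsub>M\<^esub> x" "C <+>\<^bsub>M\<lparr>carrier := Y\<rparr>\<^esub> D = C <+>\<^bsub>M\<^esub> D"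
    for C D Y x by (simp_all add: a_r_coset_def' set_add_def')
  have inj: "B +>\<^bsub>M\<^esub> x = B +>\<^bsub>M\<^esub> y"
    if "x \<in> Z'" "y \<in> Z'" "(Z' \<inter> B) +>\<^bsub>M\<^esub> x = (Z' \<inter> B) +>\<^bsub>M\<^esub> y" for x y
  proof -
    have "\<zero>\<^bsub>M\<^esub> \<in> Z' \<inter> B"
      using subgroup.one_closed[OF sgB] subgroup.one_closed[OF sgZ] by simp
    then have "\<zero>\<^bsub>M\<^esub> \<oplus>\<^bsub>M\<^esub> x \<in> (Z' \<inter> B) +>\<^bsub>M\<^esub> x" by (auto simp: a_r_coset_def')
    moreover have "\<zero>\<^bsub>M\<^esub> \<oplus>\<^bsub>M\<^esub> x = x" using that(1) ZM by auto
    ultimately have "x \<in> (Z' \<inter> B) +>\<^bsub>M\<^esub> y" using that(3) by simp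
    then have "x \<in> B +>\<^bsub>M\<^esub> y" by (auto simp: a_r_coset_def')
    then show ?thesis using M.a_repr_independence that ZM sgB by blast
  qed
  show ?thesis
    unfolding module_isomorphic_def
  proof (intro bexI[of _ h] ballI)
    fix r C assume r: "r \<in> carrier R" and "C \<in> carrier (quotient_module (M\<lparr>carrier := Z\<rparr>) B)"
    then obtain z where z: "z \<in> Z'" "C = B +>\<^bsub>M\<^esub> z"
      by (auto simp: quotient_module_def cosets)
    have "r \<odot>\<^bsub>M\<^esub> z \<in> Z'" using submoduleE(4)[OF Z'] r z by simp
    then show "h (r \<odot>\<^bsub>quotient_module (M\<lparr>carrier := Z\<rparr>) B\<^esub> C) =
        r \<odot>\<^bsub>quotient_module (M\<lparr>carrier := Z'\<rparr>) (Z' \<inter> B)\<^esub> h C"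
      using z r subsetD[OF ZM z(1)]
      by (simp add: quotient_module_def coset_upd coset_smult[OF B] coset_smult[OF I] h_coset)
  next
    show "h \<in> iso (add_monoid (quotient_module (M\<lparr>carrier := Z\<rparr>) B))
                  (add_monoid (quotient_module (M\<lparr>carrier := Z'\<rparr>) (Z' \<inter> B)))"
    proof (rule isoI)
      show "h \<in> hom (add_monoid (quotient_module (M\<lparr>carrier := Z\<rparr>) B))
                  (add_monoid (quotient_module (M\<lparr>carrier := Z'\<rparr>) (Z' \<inter> B)))"
      proof (rule homI)
        fix C D
        assume "C \<in> carrier (add_monoid (quotient_module (M\<lparr>carrier := Z\<rparr>) B))"
          and "D \<in> carrier (add_monoid (quotient_module (M\<lparr>carrier := Z\<rparr>) B))"
        then obtain x y where xy: "x \<in> Z'" "C = B +>\<^bsub>M\<^esub> x" "y \<in> Z'" "D = B +>\<^bsub>M\<^esub> y"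
          by (auto simp: quotient_module_def cosets)
        have "x \<oplus>\<^bsub>M\<^esub> y \<in> Z'" using submoduleE(5)[OF Z'] xy by simp
        then show "h (C \<otimes>\<^bsub>add_monoid (quotient_module (M\<lparr>carrier := Z\<rparr>) B)\<^esub> D) =
            h C \<otimes>\<^bsub>add_monoid (quotient_module (M\<lparr>carrier := Z'\<rparr>) (Z' \<inter> B))\<^esub> h D"
          using xy subsetD[OF ZM]
          by (simp add: quotient_module_def coset_upd coset_add[OF B] coset_add[OF I] h_coset)
      qed (auto simp: quotient_module_def cosets cosets' h_coset)
      show "bij_betw h (carrier (add_monoid (quotient_module (M\<lparr>carrier := Z\<rparr>) B)))
                  (carrier (add_monoid (quotient_module (M\<lparr>carrier := Z'\<rparr>) (Z' \<inter> B))))"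
        unfolding bij_betw_def
      proof
        show "inj_on h (carrier (add_monoid (quotient_module (M\<lparr>carrier := Z\<rparr>) B)))"
        proof (rule inj_onI)
          fix C D
          assume "C \<in> carrier (add_monoid (quotient_module (M\<lparr>carrier := Z\<rparr>) B))"
            and "D \<in> carrier (add_monoid (quotient_module (M\<lparr>carrier := Z\<rparr>) B))"
          then obtain x y where xy: "x \<in> Z'" "C = B +>\<^bsub>M\<^esub> x" "y \<in> Z'" "D = B +>\<^bsub>M\<^esub> y"
            by (auto simp: quotient_module_def cosets)
          assume "h C = h D"
          then show "C = D" using inj[OF xy(1,3)] xy by (simp add: h_coset)
        qed
      qed (auto simp: quotient_module_def cosets cosets' h_coset image_image)
    qed
  qed
qed

lemma (in abelian_monoid) finsum_swap:
  assumes "finite A" "finite B" "\<And>x y. \<lbrakk>x \<in> A; y \<in> B\<rbrakk> \<Longrightarrow> f x y \<in> carrier G"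
  shows "(\<Oplus>x\<in>A. \<Oplus>y\<in>B. f x y) = (\<Oplus>y\<in>B. \<Oplus>x\<in>A. f x y)"
  using assms(1,3)
proof (induction A)
  case empty
  then show ?case by simp
next
  case (insert a A)
  have "(\<Oplus>x\<in>insert a A. \<Oplus>y\<in>B. f x y) = (\<Oplus>y\<in>B. f a y) \<oplus> (\<Oplus>y\<in>B. \<Oplus>x\<in>A. f x y)"
    using insert by (subst finsum_insert) (auto intro!: finsum_closed)
  also have "\<dots> = (\<Oplus>y\<in>B. f a y \<oplus> (\<Oplus>x\<in>A. f x y))"
    using insert by (subst finsum_addf) (auto intro!: finsum_closed)
  also have "\<dots> = (\<Oplus>y\<in>B. \<Oplus>x\<in>insert a A. f x y)"
    using insert by (intro finsum_cong') (auto intro!: finsum_closed simp: finsum_insert Pi_def)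
  finally show ?case .
qed


section \<open>Free modules\<close>

lemma free_module_simps [simp]:
  "\<zero>\<^bsub>free_module R B\<^esub> = (\<lambda>b. \<zero>\<^bsub>R\<^esub>)"
  "c \<oplus>\<^bsub>free_module R B\<^esub> d = (\<lambda>b. c b \<oplus>\<^bsub>R\<^esub> d b)"
  "r \<odot>\<^bsub>free_module R B\<^esub> c = (\<lambda>b. r \<otimes>\<^bsub>R\<^esub> c b)"
  by (simp_all add: free_module_def)

lemma carrier_free_module:
  "carrier (free_module R B) = {c. (\<forall>b. c b \<in> carrier R) \<and> (\<forall>b. b \<notin> B \<longrightarrow> c b = \<zero>\<^bsub>R\<^esub>)
     \<and> finite {b. c b \<noteq> \<zero>\<^bsub>R\<^esub>}}"
  by (simp add: free_module_def)

lemma carrier_free_module_finite: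
  assumes "finite B"
  shows "carrier (free_module R B) = {c. (\<forall>b. c b \<in> carrier R) \<and> (\<forall>b. b \<notin> B \<longrightarrow> c b = \<zero>\<^bsub>R\<^esub>)}"
proof -
  have "finite {b. c b \<noteq> \<zero>\<^bsub>R\<^esub>}" if "\<forall>b. b \<notin> B \<longrightarrow> c b = \<zero>\<^bsub>R\<^esub>" for c
    by (rule finite_subset[OF _ assms]) (use that in auto)
  then show ?thesis by (auto simp: carrier_free_module)
qed

lemma (in cring) free_module_is_module: "module R (free_module R B)"
proof -
  have add: "finite {b. c b \<oplus> d b \<noteq> \<zero>}" if "finite {b. c b \<noteq> \<zero>}" "finite {b. d b \<noteq> \<zero>}"
    for c d :: "'c \<Rightarrow> 'a"
  proof (rule finite_subset)
    show "{b. c b \<oplus> d b \<noteq> \<zero>} \<subseteq> {b. c b \<noteq> \<zero>} \<union> {b. d b \<noteq> \<zero>}" by auto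
  qed (use that in auto)
  have smult: "finite {b. r \<otimes> c b \<noteq> \<zero>}" if "finite {b. c b \<noteq> \<zero>}" "r \<in> carrier R"
    for r and c :: "'c \<Rightarrow> 'a"
    by (rule finite_subset[OF _ that(1)]) (use that in auto)
  show ?thesis
  proof (rule moduleI)
    show "cring R" by (rule cring_axioms)
    show "abelian_group (free_module R B)"
    proof (rule abelian_groupI)
      fix c assume c: "c \<in> carrier (free_module R B)"
      show "\<exists>d\<in>carrier (free_module R B). d \<oplus>\<^bsub>free_module R B\<^esub> c = \<zero>\<^bsub>free_module R B\<^esub>"
      proof
        show "(\<lambda>b. \<ominus> c b) \<in> carrier (free_module R B)"
        proof -
          have "finite {b. \<ominus> c b \<noteq> \<zero>}"
            by (rule finite_subset[of _ "{b. c b \<noteq> \<zero>}"]) (use c in \<open>auto simp: carrier_free_module\<close>)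
          then show ?thesis using c by (auto simp: carrier_free_module)
        qed
      qed (use c in \<open>simp add: carrier_free_module l_neg\<close>)
    qed (auto simp: carrier_free_module add a_ac)
  qed (auto simp: carrier_free_module smult l_distr r_distr m_assoc)
qed

text \<open>Addition in the free module is pointwise. This turns sums of chains into sums in the
  ring, one coefficient at a time.\<close>

lemma (in cring) finsum_free_module:
  assumes "finite A" "f \<in> A \<rightarrow> carrier (free_module R B)"
  shows "(\<Oplus>\<^bsub>free_module R B\<^esub> i\<in>A. f i) = (\<lambda>b. \<Oplus>i\<in>A. f i b)"
proof -
  interpret F: module R "free_module R B" by (rule free_module_is_module)
  show ?thesis
    using assms
  proof (induction A)
    case empty
    then show ?case by simp
  next
    case (insert a A)
    then have "(\<lambda>i. f i b) \<in> A \<rightarrow> carrier R" "f a b \<in> carrier R" for b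
      by (auto simp: carrier_free_module Pi_def)
    with insert show ?case by (simp add: F.M.finsum_insert finsum_insert)
  qed
qed

lemma (in cring) basis_vector_in_carrier:
  assumes "b \<in> B" shows "basis_vector R b \<in> carrier (free_module R B)"
proof -
  have "finite {x. basis_vector R b x \<noteq> \<zero>}"
    by (rule finite_subset[of _ "{b}"]) (auto simp: basis_vector_def)
  then show ?thesis using assms by (auto simp: carrier_free_module basis_vector_def)
qed

section \<open>Incidence numbers\<close>

text \<open>The matrix entry of the boundary map. When \<rho> is \<alpha> without \<open>x\<close>,
  the exponent counts the vertices of \<alpha> below \<open>x\<close>, that is, the position of
  \<open>x\<close> from 0. Quantifying over the difference of \<alpha> and \<rho> avoids choosing
  \<open>x\<close>.\<close>

definition incidence ::
  "('r, 'm) ring_scheme \<Rightarrow> ('v::linorder set \<Rightarrow> 'r) \<Rightarrow> 'v set \<Rightarrow> 'v set \<Rightarrow> 'r" where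
  "incidence R w \<alpha> \<rho> =
     (if \<exists>x\<in>\<alpha>. \<rho> = \<alpha> - {x}
      then exact_quotient R (w \<alpha>) (w \<rho>) \<otimes>\<^bsub>R\<^esub>
             (\<ominus>\<^bsub>R\<^esub> \<one>\<^bsub>R\<^esub>) [^]\<^bsub>R\<^esub> card {y\<in>\<alpha>. \<forall>x\<in>\<alpha> - \<rho>. y < x}
      else \<zero>\<^bsub>R\<^esub>)"

lemma incidence_remove:
  assumes "x \<in> \<alpha>"
  shows "incidence R w \<alpha> (\<alpha> - {x}) =
    exact_quotient R (w \<alpha>) (w (\<alpha> - {x})) \<otimes>\<^bsub>R\<^esub> (\<ominus>\<^bsub>R\<^esub> \<one>\<^bsub>R\<^esub>) [^]\<^bsub>R\<^esub> card {y\<in>\<alpha>. y < x}"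
proof -
  have "\<alpha> - (\<alpha> - {x}) = {x}" using assms by auto
  then show ?thesis using assms by (auto simp: incidence_def)
qed

lemma incidence_nonzeroD:
  assumes "incidence R w \<alpha> \<rho> \<noteq> \<zero>\<^bsub>R\<^esub>"
  shows "\<exists>x\<in>\<alpha>. \<rho> = \<alpha> - {x}"
  using assms by (auto simp: incidence_def split: if_splits)

text \<open>The sorted list is strictly increasing, so the vertices below its \<open>i\<close>-th
  entry are those at the indices below \<open>i\<close>. This trades list positions for counts that
  refer only to the order.\<close>

lemma card_less_nth_sorted_list_of_set:
  assumes "finite \<alpha>" "i < card \<alpha>"
  shows "card {y\<in>\<alpha>. y < sorted_list_of_set \<alpha> ! i} = i"
proof -
  define xs where "xs = sorted_list_of_set \<alpha>"
  have xs: "set xs = \<alpha>" "length xs = card \<alpha>" "sorted_wrt (<) xs"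
    using assms by (auto simp: xs_def)
  have less: "xs ! j < xs ! k \<longleftrightarrow> j < k" if "j < length xs" "k < length xs" for j k
    using sorted_wrt_nth_less[OF xs(3)] that by (metis not_less_iff_gr_or_eq)
  have "{y\<in>\<alpha>. y < xs ! i} = (!) xs ` {..<i}"
  proof (intro equalityI subsetI)
    fix y assume "y \<in> {y\<in>\<alpha>. y < xs ! i}"
    then obtain j where "j < length xs" "y = xs ! j" "xs ! j < xs ! i"
      using xs by (auto simp: in_set_conv_nth)
    then show "y \<in> (!) xs ` {..<i}" using less xs assms by auto
  next
    fix y assume "y \<in> (!) xs ` {..<i}"
    then obtain j where "j < i" "y = xs ! j" by auto
    then show "y \<in> {y\<in>\<alpha>. y < xs ! i}" using less xs assms nth_mem[of j xs] by auto
  qed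
  moreover have "inj_on ((!) xs) {..<i}"
    using assms xs by (auto simp: inj_on_def xs_def nth_eq_iff_index_eq)
  ultimately show ?thesis by (simp add: card_image xs_def)
qed

lemma face_card_less:
  assumes "finite \<alpha>" "x \<in> \<alpha>"
  shows "face (card {y\<in>\<alpha>. y < x}) \<alpha> = \<alpha> - {x}" "card {y\<in>\<alpha>. y < x} < card \<alpha>"
proof -
  obtain i where "i < card \<alpha>" "x = sorted_list_of_set \<alpha> ! i"
    using assms by (metis in_set_conv_nth set_sorted_list_of_set length_sorted_list_of_set)
  with assms show "face (card {y\<in>\<alpha>. y < x}) \<alpha> = \<alpha> - {x}" "card {y\<in>\<alpha>. y < x} < card \<alpha>"
    by (simp_all add: card_less_nth_sorted_list_of_set face_def)
qed

lemma face_eq_remove: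
  assumes "finite \<alpha>" "i < card \<alpha>"
  shows "sorted_list_of_set \<alpha> ! i \<in> \<alpha>" "face i \<alpha> = \<alpha> - {sorted_list_of_set \<alpha> ! i}"
  using assms nth_mem[of i "sorted_list_of_set \<alpha>"] by (auto simp: face_def)

text \<open>Cancelling the nonzero \<open>y\<close> makes the quotient unique, so the description
  operator picks it.\<close>

lemma (in domain) exact_quotient_eq:
  assumes "y \<in> carrier R" "y \<noteq> \<zero>" "q \<in> carrier R" "x = y \<otimes> q"
  shows "exact_quotient R x y = q"
  unfolding exact_quotient_def
  by (rule the_equality) (use assms m_lcancel in auto)

lemma (in domain) exact_quotient_divides:
  assumes "y \<in> carrier R" "y \<noteq> \<zero>" "y divides x"
  shows "exact_quotient R x y \<in> carrier R" "y \<otimes> exact_quotient R x y = x"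
  using assms exact_quotient_eq unfolding factor_def by metis+

text \<open>The intermediate weight cancels. Hence the two ways of deleting two vertices from a
  simplex contribute the same weight factor to the squared boundary.\<close>

lemma (in domain) exact_quotient_mult:
  assumes "x \<in> carrier R" "y \<in> carrier R" "y \<noteq> \<zero>" "z \<in> carrier R" "z \<noteq> \<zero>"
    and "y divides x" "z divides y"
  shows "exact_quotient R x y \<otimes> exact_quotient R y z = exact_quotient R x z"
proof -
  note xy = exact_quotient_divides[OF assms(2,3,6)]
  note yz = exact_quotient_divides[OF assms(4,5,7)]
  have "z \<otimes> (exact_quotient R x y \<otimes> exact_quotient R y z) =
      (z \<otimes> exact_quotient R y z) \<otimes> exact_quotient R x y"
    using xy(1) yz(1) assms(4) by (simp add: m_ac)
  then have "x = z \<otimes> (exact_quotient R x y \<otimes> exact_quotient R y z)"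
    using xy yz by simp
  from exact_quotient_eq[OF assms(4,5) m_closed[OF xy(1) yz(1)] this] show ?thesis by (rule sym)
qed

section \<open>The weighted boundary as a matrix of incidence numbers\<close>

locale weighted_complex = domain R for R (structure) +
  fixes K :: "'v::linorder set set" and w :: "'v set \<Rightarrow> 'a"
  assumes wsc: "weighted_simplicial_complex R K w"
begin

abbreviation simplices where "simplices \<equiv> weighted_simplices R K w"
abbreviation chains where "chains \<equiv> weighted_chains R K w"
abbreviation bd where "bd \<equiv> weighted_boundary R K w"

lemma finite_simplices: "finite (simplices n)"
  using wsc by (auto simp: weighted_simplicial_complex_def abstract_simplicial_complex_def
      weighted_simplices_def)

lemma finite_simplex: "\<alpha> \<in> K \<Longrightarrow> finite \<alpha>"
  using wsc by (auto simp: weighted_simplicial_complex_def abstract_simplicial_complex_def)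

lemma simplex_nonempty: "\<alpha> \<in> K \<Longrightarrow> \<alpha> \<noteq> {}"
  using wsc by (auto simp: weighted_simplicial_complex_def abstract_simplicial_complex_def)

lemma weight_closed: "\<alpha> \<in> K \<Longrightarrow> w \<alpha> \<in> carrier R"
  using wsc by (auto simp: weighted_simplicial_complex_def)

lemma weight_divides: "\<lbrakk>\<alpha> \<in> K; \<rho> \<in> K; \<rho> \<subseteq> \<alpha>\<rbrakk> \<Longrightarrow> w \<rho> divides w \<alpha>"
  using wsc by (auto simp: weighted_simplicial_complex_def)

lemma simplicesD:
  assumes "\<alpha> \<in> simplices n"
  shows "\<alpha> \<in> K" "finite \<alpha>" "int (card \<alpha>) = n + 1" "w \<alpha> \<noteq> \<zero>"
  using assms finite_simplex by (auto simp: weighted_simplices_def simplex_dim_def)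

text \<open>Zero divides only zero, so a face of a simplex of nonzero weight has nonzero weight. The
  bound on \<open>n\<close> keeps the face nonempty.\<close>

lemma remove_in_simplices:
  assumes "\<alpha> \<in> simplices n" "x \<in> \<alpha>" "n \<ge> 1"
  shows "\<alpha> - {x} \<in> simplices (n - 1)"
proof -
  note \<alpha> = simplicesD[OF assms(1)]
  have card: "int (card (\<alpha> - {x})) = n" using \<alpha> assms by (simp add: of_nat_diff card_gt_0_iff)
  then have "card (\<alpha> - {x}) \<noteq> 0" using assms(3) by linarith
  then have "\<alpha> - {x} \<noteq> {}" by (metis card.empty)
  then have K: "\<alpha> - {x} \<in> K"
    using wsc \<alpha>(1) unfolding weighted_simplicial_complex_def abstract_simplicial_complex_def
    by (meson Diff_subset)
  have "w (\<alpha> - {x}) divides w \<alpha>" using weight_divides \<alpha>(1) K by blast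
  then have "w (\<alpha> - {x}) \<noteq> \<zero>" using \<alpha>(1,4) weight_closed by (auto simp: factor_def)
  then show ?thesis using K card by (simp add: weighted_simplices_def simplex_dim_def)
qed

lemma exact_quotient_weight_closed:
  assumes "\<alpha> \<in> simplices n" "x \<in> \<alpha>" "n \<ge> 1"
  shows "exact_quotient R (w \<alpha>) (w (\<alpha> - {x})) \<in> carrier R"
  using exact_quotient_divides(1) weight_divides weight_closed simplicesD(1)[OF assms(1)]
    simplicesD(1,4)[OF remove_in_simplices[OF assms]] by blast

lemma incidence_closed:
  assumes "\<alpha> \<in> simplices n" "n \<ge> 1"
  shows "incidence R w \<alpha> \<rho> \<in> carrier R"
  using exact_quotient_weight_closed[OF assms(1) _ assms(2)] by (auto simp: incidence_def)

lemma incidence_eq_zero: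
  assumes "\<alpha> \<in> simplices n" "n \<ge> 1" "\<rho> \<notin> simplices (n - 1)"
  shows "incidence R w \<alpha> \<rho> = \<zero>"
  using incidence_nonzeroD[of R w \<alpha> \<rho>] remove_in_simplices[OF assms(1) _ assms(2)] assms(3)
  by auto

lemma simplex_boundary_eq_incidence:
  assumes "\<alpha> \<in> simplices n" "n \<ge> 1"
  shows "simplex_boundary R K w n \<alpha> = incidence R w \<alpha>"
proof
  fix \<rho>
  note \<alpha> = simplicesD[OF assms(1)]
  define f where "f i = exact_quotient R (w \<alpha>) (w (face i \<alpha>)) \<otimes> (\<ominus> \<one>) [^] i" for i
  have I: "i < card \<alpha>" if "i \<in> {0..nat n}" for i using that \<alpha>(3) assms(2) by auto
  have f: "f i \<in> carrier R" if "i \<in> {0..nat n}" for i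
    using face_eq_remove[OF \<alpha>(2) I[OF that]] exact_quotient_weight_closed assms by (simp add: f_def)
  have face: "face i \<alpha> \<in> simplices (n - 1)" if "i \<in> {0..nat n}" for i
    using face_eq_remove[OF \<alpha>(2) I[OF that]] remove_in_simplices assms by simp
  interpret C: module R "chains (n - 1)"
    unfolding weighted_chains_def by (rule free_module_is_module)
  have "f i \<odot>\<^bsub>chains (n - 1)\<^esub> basis_vector R (face i \<alpha>) \<in> carrier (chains (n - 1))"
    if "i \<in> {0..nat n}" for i
    using C.smult_closed[OF f[OF that]] basis_vector_in_carrier[OF face[OF that]]
    by (simp add: weighted_chains_def)
  then have "simplex_boundary R K w n \<alpha> \<rho> =
      (\<Oplus>i\<in>{0..nat n}. f i \<otimes> basis_vector R (face i \<alpha>) \<rho>)"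
    unfolding simplex_boundary_def f_def weighted_chains_def
    by (subst finsum_free_module) auto
  also have "\<dots> = incidence R w \<alpha> \<rho>"
  proof (cases "\<exists>x\<in>\<alpha>. \<rho> = \<alpha> - {x}")
    case True
    then obtain x where x: "x \<in> \<alpha>" "\<rho> = \<alpha> - {x}" by blast
    \<comment> \<open>The position of \<open>x\<close> in the sorted vertex list. It is the only
      index whose face is \<rho>, so one summand survives.\<close>
    define k where "k = card {y\<in>\<alpha>. y < x}"
    have k: "face k \<alpha> = \<rho>" "k \<in> {0..nat n}"
      using face_card_less[OF \<alpha>(2) x(1)] x \<alpha>(3) by (auto simp: k_def)
    have "face i \<alpha> = \<rho> \<longleftrightarrow> k = i" if "i \<in> {0..nat n}" for i
    proof
      assume *: "face i \<alpha> = \<rho>"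
      note i = face_eq_remove[OF \<alpha>(2) I[OF that]]
      have "sorted_list_of_set \<alpha> ! i = x" using * i x by blast
      then show "k = i"
        using card_less_nth_sorted_list_of_set[OF \<alpha>(2) I[OF that]] by (simp add: k_def)
    qed (use k in simp)
    then have "(\<Oplus>i\<in>{0..nat n}. f i \<otimes> basis_vector R (face i \<alpha>) \<rho>) =
        (\<Oplus>i\<in>{0..nat n}. if k = i then f i else \<zero>)"
      using f by (intro finsum_cong') (auto simp: basis_vector_def)
    also have "\<dots> = f k" using f k by (intro finsum_singleton) auto
    also have "\<dots> = incidence R w \<alpha> \<rho>"
      using incidence_remove[OF x(1), of R w] x(2) k(1) by (simp add: f_def k_def)
    finally show ?thesis .
  next
    case False
    have "f i \<otimes> basis_vector R (face i \<alpha>) \<rho> = \<zero>" if "i \<in> {0..nat n}" for i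
      using False face_eq_remove[OF \<alpha>(2) I[OF that]] f[OF that] by (auto simp: basis_vector_def)
    then show ?thesis using False by (subst add.finprod_one_eqI) (auto simp: incidence_def)
  qed
  finally show "simplex_boundary R K w n \<alpha> \<rho> = incidence R w \<alpha> \<rho>" .
qed

lemma chains_is_module: "module R (chains n)"
  unfolding weighted_chains_def by (rule free_module_is_module)

lemma carrier_chains:
  "carrier (chains n) = {c. (\<forall>\<alpha>. c \<alpha> \<in> carrier R) \<and> (\<forall>\<alpha>. \<alpha> \<notin> simplices n \<longrightarrow> c \<alpha> = \<zero>)}"
  unfolding weighted_chains_def by (rule carrier_free_module_finite[OF finite_simplices])

lemma chains_simps [simp]:
  "\<zero>\<^bsub>chains n\<^esub> = (\<lambda>\<alpha>. \<zero>)"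
  "c \<oplus>\<^bsub>chains n\<^esub> d = (\<lambda>\<alpha>. c \<alpha> \<oplus> d \<alpha>)"
  "r \<odot>\<^bsub>chains n\<^esub> c = (\<lambda>\<alpha>. r \<otimes> c \<alpha>)"
  by (simp_all add: weighted_chains_def)

text \<open>From here on the boundary is handled only through its matrix: sorted lists and sums in
  chain modules do not occur again in the arguments about it.\<close>

lemma bd_eq_sum_incidence:
  assumes "c \<in> carrier (chains n)" "n \<ge> 1"
  shows "bd n c \<rho> = (\<Oplus>\<alpha>\<in>simplices n. c \<alpha> \<otimes> incidence R w \<alpha> \<rho>)"
proof -
  have "(\<lambda>\<rho>. c \<alpha> \<otimes> incidence R w \<alpha> \<rho>) \<in> carrier (chains (n - 1))" if "\<alpha> \<in> simplices n" for \<alpha>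
    using assms that incidence_closed incidence_eq_zero by (auto simp: carrier_chains)
  then have "(\<Oplus>\<^bsub>chains (n - 1)\<^esub> \<alpha>\<in>simplices n. c \<alpha> \<odot>\<^bsub>chains (n - 1)\<^esub> incidence R w \<alpha>) \<rho> =
      (\<Oplus>\<alpha>\<in>simplices n. c \<alpha> \<otimes> incidence R w \<alpha> \<rho>)"
    unfolding weighted_chains_def by (subst finsum_free_module[OF finite_simplices]) auto
  moreover have "(\<Oplus>\<^bsub>chains (n - 1)\<^esub> \<alpha>\<in>simplices n. c \<alpha> \<odot>\<^bsub>chains (n - 1)\<^esub> simplex_boundary R K w n \<alpha>) =
      (\<Oplus>\<^bsub>chains (n - 1)\<^esub> \<alpha>\<in>simplices n. c \<alpha> \<odot>\<^bsub>chains (n - 1)\<^esub> incidence R w \<alpha>)"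
  proof -
    interpret C: module R "chains (n - 1)" by (rule chains_is_module)
    show ?thesis
      using assms(2) calculation
      by (intro C.M.finsum_cong') (use \<open>\<And>\<alpha>. \<alpha> \<in> simplices n \<Longrightarrow> _ \<in> _\<close> simplex_boundary_eq_incidence in auto)
  qed
  ultimately show ?thesis using assms(2) by (simp add: weighted_boundary_def)
qed

lemma bd_nonpos: "n \<le> 0 \<Longrightarrow> bd n c = (\<lambda>\<alpha>. \<zero>)"
  by (simp add: weighted_boundary_def)

lemma bd_closed:
  assumes "c \<in> carrier (chains n)"
  shows "bd n c \<in> carrier (chains (n - 1))"
proof (cases "n \<ge> 1")
  case True
  have "c \<alpha> \<otimes> incidence R w \<alpha> \<rho> \<in> carrier R" if "\<alpha> \<in> simplices n" for \<alpha> \<rho>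
    using assms that incidence_closed True by (auto simp: carrier_chains)
  moreover have "c \<alpha> \<otimes> incidence R w \<alpha> \<rho> = \<zero>" if "\<alpha> \<in> simplices n" "\<rho> \<notin> simplices (n - 1)" for \<alpha> \<rho>
    using assms that incidence_eq_zero True by (auto simp: carrier_chains)
  ultimately show ?thesis
    by (auto simp: carrier_chains bd_eq_sum_incidence[OF assms True] intro!: finsum_closed
        add.finprod_one_eqI)
qed (use bd_nonpos in \<open>simp add: carrier_chains\<close>)

lemma bd_add:
  assumes "c \<in> carrier (chains n)" "d \<in> carrier (chains n)"
  shows "bd n (\<lambda>\<alpha>. c \<alpha> \<oplus> d \<alpha>) = (\<lambda>\<alpha>. bd n c \<alpha> \<oplus> bd n d \<alpha>)"
proof (cases "n \<ge> 1")
  case True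
  have cd: "(\<lambda>\<alpha>. c \<alpha> \<oplus> d \<alpha>) \<in> carrier (chains n)" using assms by (auto simp: carrier_chains)
  have carr: "c \<alpha> \<in> carrier R" "d \<alpha> \<in> carrier R" for \<alpha>
    using assms by (auto simp: carrier_chains)
  have "(\<Oplus>\<alpha>\<in>simplices n. (c \<alpha> \<oplus> d \<alpha>) \<otimes> incidence R w \<alpha> \<rho>) =
      (\<Oplus>\<alpha>\<in>simplices n. c \<alpha> \<otimes> incidence R w \<alpha> \<rho> \<oplus> d \<alpha> \<otimes> incidence R w \<alpha> \<rho>)" for \<rho>
    using carr incidence_closed True by (intro finsum_cong') (auto simp: l_distr)
  then show ?thesis
    using carr incidence_closed True
    by (auto simp: bd_eq_sum_incidence[OF _ True] assms cd intro!: finsum_addf)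
qed (use bd_nonpos in simp)

lemma bd_smult:
  assumes "c \<in> carrier (chains n)" "r \<in> carrier R"
  shows "bd n (\<lambda>\<alpha>. r \<otimes> c \<alpha>) = (\<lambda>\<alpha>. r \<otimes> bd n c \<alpha>)"
proof (cases "n \<ge> 1")
  case True
  have rc: "(\<lambda>\<alpha>. r \<otimes> c \<alpha>) \<in> carrier (chains n)" using assms by (auto simp: carrier_chains)
  have carr: "c \<alpha> \<in> carrier R" for \<alpha> using assms by (auto simp: carrier_chains)
  have "(\<Oplus>\<alpha>\<in>simplices n. (r \<otimes> c \<alpha>) \<otimes> incidence R w \<alpha> \<rho>) =
      (\<Oplus>\<alpha>\<in>simplices n. r \<otimes> (c \<alpha> \<otimes> incidence R w \<alpha> \<rho>))" for \<rho>
    using carr incidence_closed True assms(2) by (intro finsum_cong') (auto simp: m_assoc)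
  then show ?thesis
    using carr incidence_closed True finite_simplices
    by (auto simp: bd_eq_sum_incidence[OF _ True] assms rc finsum_rdistr)
qed (use bd_nonpos assms in simp)

section \<open>The square of the boundary vanishes\<close>

text \<open>If \<rho> is \<tau> without \<open>x < y\<close>, only the two simplices between them
  contribute. Their weight factors agree, and their signs are opposite: deleting \<open>x\<close>
  first lowers the position of \<open>y\<close> by one, while deleting \<open>y\<close> first leaves
  the position of \<open>x\<close> unchanged. For any other \<rho> no summand is nonzero.\<close>

lemma sum_incidence_incidence:
  assumes \<tau>: "\<tau> \<in> simplices n" and n: "n \<ge> 2"
  shows "(\<Oplus>\<alpha>\<in>simplices (n - 1). incidence R w \<tau> \<alpha> \<otimes> incidence R w \<alpha> \<rho>) = \<zero>"
proof (cases "\<exists>x\<in>\<tau>. \<exists>y\<in>\<tau>. x < y \<and> \<rho> = \<tau> - {x, y}")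
  case True
  then obtain x y where xy: "x \<in> \<tau>" "y \<in> \<tau>" "x < y" and \<rho>: "\<rho> = \<tau> - {x, y}" by blast
  have \<rho>': "\<rho> = \<tau> - {x} - {y}" "\<rho> = \<tau> - {y} - {x}" using \<rho> by auto
  let ?f = "\<lambda>\<alpha>. incidence R w \<tau> \<alpha> \<otimes> incidence R w \<alpha> \<rho>"
  let ?q = "exact_quotient R"
  have mem: "\<tau> - {x} \<in> simplices (n - 1)" "\<tau> - {y} \<in> simplices (n - 1)"
    using remove_in_simplices[OF \<tau>] xy n by auto
  have mem\<rho>: "\<rho> \<in> simplices (n - 1 - 1)"
    unfolding \<rho>' by (rule remove_in_simplices) (use mem xy n in auto)
  have f_carr: "?f \<alpha> \<in> carrier R" if "\<alpha> \<in> simplices (n - 1)" for \<alpha>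
    using incidence_closed[OF \<tau>] incidence_closed[OF that] n by simp
  \<comment> \<open>A nonzero product forces \<alpha> to be \<tau> without some \<open>z\<close>,
    with \<rho> a face of \<alpha>. Then \<open>z\<close> is missing from \<rho>, so it is
    \<open>x\<close> or \<open>y\<close>.\<close>
  have f_zero: "?f \<alpha> = \<zero>" if "\<alpha> \<in> simplices (n - 1) - {\<tau> - {x}, \<tau> - {y}}" for \<alpha>
  proof (rule ccontr)
    have c: "incidence R w \<tau> \<alpha> \<in> carrier R" "incidence R w \<alpha> \<rho> \<in> carrier R"
      using incidence_closed[OF \<tau>] incidence_closed[of \<alpha> "n - 1"] that n by auto
    assume "?f \<alpha> \<noteq> \<zero>"
    then have "incidence R w \<tau> \<alpha> \<noteq> \<zero>" "incidence R w \<alpha> \<rho> \<noteq> \<zero>" using c by auto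
    then obtain z u where "z \<in> \<tau>" "\<alpha> = \<tau> - {z}" "\<rho> = \<alpha> - {u}"
      using incidence_nonzeroD by meson
    then show False using that \<rho> by auto
  qed
  \<comment> \<open>\<open>p\<close> is the position of \<open>x\<close>, both in \<tau> and after
    deleting \<open>y\<close>; \<open>s\<close> is the position of \<open>y\<close> after deleting
    \<open>x\<close>, hence \<open>Suc s\<close> in \<tau>.\<close>
  define p where "p = card {z\<in>\<tau>. z < x}"
  define s where "s = card {z\<in>\<tau> - {x}. z < y}"
  have p: "card {z\<in>\<tau> - {y}. z < x} = p"
    unfolding p_def using xy by (intro arg_cong[of _ _ card]) auto
  have s: "card {z\<in>\<tau>. z < y} = Suc s"
  proof -
    have "{z\<in>\<tau>. z < y} = insert x {z\<in>\<tau> - {x}. z < y}" using xy by auto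
    then show ?thesis using simplicesD(2)[OF \<tau>] by (simp add: s_def)
  qed
  define Q where "Q = ?q (w \<tau>) (w \<rho>)"
  have \<tau>K: "\<tau> \<in> K" "w \<tau> \<noteq> \<zero>" and \<rho>K: "\<rho> \<in> K" "w \<rho> \<noteq> \<zero>"
    using simplicesD[OF \<tau>] simplicesD[OF mem\<rho>] by auto
  have Q: "Q \<in> carrier R"
    unfolding Q_def using exact_quotient_divides(1) weight_divides[OF \<tau>K(1) \<rho>K(1)]
      weight_closed \<rho> \<rho>K by blast
  have qq: "?q (w \<tau>) (w (\<tau> - {z})) \<otimes> ?q (w (\<tau> - {z})) (w \<rho>) = Q" if "z \<in> {x, y}" for z
  proof -
    have z: "\<tau> - {z} \<in> K" "w (\<tau> - {z}) \<noteq> \<zero>" using mem that simplicesD by blast+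
    show ?thesis
      unfolding Q_def using that \<rho> weight_closed weight_divides \<tau>K \<rho>K z
      by (intro exact_quotient_mult) auto
  qed
  have q_carr: "?q (w \<tau>) (w (\<tau> - {z})) \<in> carrier R" "?q (w (\<tau> - {z})) (w \<rho>) \<in> carrier R"
    if "z \<in> {x, y}" for z
  proof -
    have z: "\<tau> - {z} \<in> K" "w (\<tau> - {z}) \<noteq> \<zero>" using mem that simplicesD by blast+
    show "?q (w \<tau>) (w (\<tau> - {z})) \<in> carrier R" "?q (w (\<tau> - {z})) (w \<rho>) \<in> carrier R"
      using that \<rho> z \<tau>K \<rho>K weight_closed weight_divides
      by (auto intro!: exact_quotient_divides(1))
  qed
  have fx: "?f (\<tau> - {x}) = Q \<otimes> (\<ominus> \<one>) [^] (p + s)"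
  proof -
    have "?f (\<tau> - {x}) = ?q (w \<tau>) (w (\<tau> - {x})) \<otimes> (\<ominus> \<one>) [^] p \<otimes>
        (?q (w (\<tau> - {x})) (w \<rho>) \<otimes> (\<ominus> \<one>) [^] s)"
      using incidence_remove[OF xy(1), of R w] incidence_remove[of y "\<tau> - {x}" R w] xy \<rho>'(1)
      by (simp add: p_def s_def)
    also have "\<dots> = (?q (w \<tau>) (w (\<tau> - {x})) \<otimes> ?q (w (\<tau> - {x})) (w \<rho>)) \<otimes>
        ((\<ominus> \<one>) [^] p \<otimes> (\<ominus> \<one>) [^] s)"
      using q_carr[of x] by (simp add: m_ac)
    also have "\<dots> = Q \<otimes> (\<ominus> \<one>) [^] (p + s)" using qq[of x] by (simp add: nat_pow_mult)
    finally show ?thesis .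
  qed
  have fy: "?f (\<tau> - {y}) = Q \<otimes> (\<ominus> \<one>) [^] (Suc s + p)"
  proof -
    have "?f (\<tau> - {y}) = ?q (w \<tau>) (w (\<tau> - {y})) \<otimes> (\<ominus> \<one>) [^] Suc s \<otimes>
        (?q (w (\<tau> - {y})) (w \<rho>) \<otimes> (\<ominus> \<one>) [^] p)"
      using incidence_remove[OF xy(2), of R w] incidence_remove[of x "\<tau> - {y}" R w, unfolded p]
        xy \<rho>'(2) by (simp add: s del: nat_pow_Suc)
    also have "\<dots> = (?q (w \<tau>) (w (\<tau> - {y})) \<otimes> ?q (w (\<tau> - {y})) (w \<rho>)) \<otimes>
        ((\<ominus> \<one>) [^] Suc s \<otimes> (\<ominus> \<one>) [^] p)"
      using q_carr[of y] by (simp add: m_ac del: nat_pow_Suc)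
    also have "\<dots> = Q \<otimes> (\<ominus> \<one>) [^] (Suc s + p)"
      using qq[of y] by (simp add: nat_pow_mult[symmetric] m_ac)
    finally show ?thesis .
  qed
  have "(\<Oplus>\<alpha>\<in>simplices (n - 1). ?f \<alpha>) = (\<Oplus>\<alpha>\<in>{\<tau> - {x}, \<tau> - {y}}. ?f \<alpha>)"
    using mem f_zero f_carr finite_simplices by (intro add.finprod_mono_neutral_cong_right) auto
  also have "\<dots> = ?f (\<tau> - {x}) \<oplus> ?f (\<tau> - {y})"
  proof -
    have "\<tau> - {x} \<noteq> \<tau> - {y}" using xy by auto
    then show ?thesis using f_carr mem by (simp add: finsum_insert)
  qed
  also have "\<dots> = Q \<otimes> (\<ominus> \<one>) [^] (p + s) \<oplus> Q \<otimes> ((\<ominus> \<one>) [^] (p + s) \<otimes> (\<ominus> \<one>))"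
    unfolding fx fy by (simp add: add.commute)
  also have "\<dots> = \<zero>" using Q by (simp add: r_minus r_neg)
  finally show ?thesis .
next
  case False
  have "incidence R w \<tau> \<alpha> \<otimes> incidence R w \<alpha> \<rho> = \<zero>" if "\<alpha> \<in> simplices (n - 1)" for \<alpha>
  proof (rule ccontr)
    have c: "incidence R w \<tau> \<alpha> \<in> carrier R" "incidence R w \<alpha> \<rho> \<in> carrier R"
      using incidence_closed[OF \<tau>] incidence_closed[OF that] n by auto
    assume "incidence R w \<tau> \<alpha> \<otimes> incidence R w \<alpha> \<rho> \<noteq> \<zero>"
    then have "incidence R w \<tau> \<alpha> \<noteq> \<zero>" "incidence R w \<alpha> \<rho> \<noteq> \<zero>" using c by auto
    then obtain z u where zu: "z \<in> \<tau>" "\<alpha> = \<tau> - {z}" "u \<in> \<alpha>" "\<rho> = \<alpha> - {u}"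
      using incidence_nonzeroD by meson
    \<comment> \<open>Both orders are recorded because the case hypothesis speaks of a pair with the
      smaller vertex first.\<close>
    then have "\<rho> = \<tau> - {z, u}" "\<rho> = \<tau> - {u, z}" "u \<in> \<tau>" "u \<noteq> z" by auto
    then show False using False zu(1) by (metis neqE)
  qed
  then show ?thesis by (intro add.finprod_one_eqI)
qed

lemma bd_bd:
  assumes c: "c \<in> carrier (chains n)"
  shows "bd (n - 1) (bd n c) = (\<lambda>\<alpha>. \<zero>)"
proof (cases "n \<ge> 2")
  case True
  have carr: "c \<alpha> \<in> carrier R" for \<alpha> using c by (auto simp: carrier_chains)
  have inc: "incidence R w \<tau> \<alpha> \<in> carrier R" if "\<tau> \<in> simplices n" for \<tau> \<alpha>
    using incidence_closed[OF that] True by simp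
  have inc': "incidence R w \<tau> \<alpha> \<in> carrier R" if "\<tau> \<in> simplices (n - 1)" for \<tau> \<alpha>
    using incidence_closed[OF that] True by simp
  show ?thesis
  proof
    fix \<rho>
    have "bd (n - 1) (bd n c) \<rho> = (\<Oplus>\<alpha>\<in>simplices (n - 1). bd n c \<alpha> \<otimes> incidence R w \<alpha> \<rho>)"
      using bd_eq_sum_incidence[OF bd_closed[OF c]] True by simp
    also have "\<dots> = (\<Oplus>\<alpha>\<in>simplices (n - 1). \<Oplus>\<tau>\<in>simplices n.
        c \<tau> \<otimes> (incidence R w \<tau> \<alpha> \<otimes> incidence R w \<alpha> \<rho>))"
    proof (rule finsum_cong')
      fix \<alpha> assume \<alpha>: "\<alpha> \<in> simplices (n - 1)"
      have "bd n c \<alpha> \<otimes> incidence R w \<alpha> \<rho> =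
          (\<Oplus>\<tau>\<in>simplices n. c \<tau> \<otimes> incidence R w \<tau> \<alpha> \<otimes> incidence R w \<alpha> \<rho>)"
        using bd_eq_sum_incidence[OF c] True carr inc inc'[OF \<alpha>] finite_simplices
        by (simp add: finsum_ldistr Pi_def)
      also have "\<dots> = (\<Oplus>\<tau>\<in>simplices n. c \<tau> \<otimes> (incidence R w \<tau> \<alpha> \<otimes> incidence R w \<alpha> \<rho>))"
        using carr inc inc'[OF \<alpha>] by (intro finsum_cong') (auto simp: m_assoc)
      finally show "bd n c \<alpha> \<otimes> incidence R w \<alpha> \<rho> =
          (\<Oplus>\<tau>\<in>simplices n. c \<tau> \<otimes> (incidence R w \<tau> \<alpha> \<otimes> incidence R w \<alpha> \<rho>))" .
    qed (use carr inc inc' in \<open>auto intro!: finsum_closed\<close>)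
    also have "\<dots> = (\<Oplus>\<tau>\<in>simplices n. \<Oplus>\<alpha>\<in>simplices (n - 1).
        c \<tau> \<otimes> (incidence R w \<tau> \<alpha> \<otimes> incidence R w \<alpha> \<rho>))"
      using carr inc inc' finite_simplices by (intro finsum_swap) auto
    also have "\<dots> = \<zero>"
    proof (rule add.finprod_one_eqI)
      fix \<tau> assume \<tau>: "\<tau> \<in> simplices n"
      have "(\<Oplus>\<alpha>\<in>simplices (n - 1). c \<tau> \<otimes> (incidence R w \<tau> \<alpha> \<otimes> incidence R w \<alpha> \<rho>)) =
          c \<tau> \<otimes> (\<Oplus>\<alpha>\<in>simplices (n - 1). incidence R w \<tau> \<alpha> \<otimes> incidence R w \<alpha> \<rho>)"
        using carr inc[OF \<tau>] inc' finite_simplices by (subst finsum_rdistr) auto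
      then show "(\<Oplus>\<alpha>\<in>simplices (n - 1). c \<tau> \<otimes> (incidence R w \<tau> \<alpha> \<otimes> incidence R w \<alpha> \<rho>)) = \<zero>"
        using sum_incidence_incidence[OF \<tau> True] carr by simp
    qed
    finally show "bd (n - 1) (bd n c) \<rho> = \<zero>" .
  qed
\<comment> \<open>For \<open>n\<close> at most 1 the outer boundary starts in degree at most 0,
  where it is zero by definition.\<close>
qed (simp add: bd_nonpos)

end

section \<open>Cycles and boundaries as submodules\<close>

context weighted_complex
begin

abbreviation cycles where "cycles \<equiv> weighted_cycles R K w"
abbreviation boundaries where "boundaries \<equiv> weighted_boundaries R K w"

lemma cycles_eq: "cycles n = {c \<in> carrier (chains n). bd n c = (\<lambda>\<alpha>. \<zero>)}"
  by (simp add: weighted_cycles_def a_kernel_def')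

lemma submodule_cycles: "submodule (cycles n) R (chains n)"
proof -
  interpret C: module R "chains n" by (rule chains_is_module)
  show ?thesis
  proof (rule C.submodule_of_lin_closed)
    \<comment> \<open>Homogeneity for the scalar zero yields that the boundary of the zero chain
      vanishes.\<close>
    have "bd n (\<lambda>\<alpha>. \<zero> \<otimes> \<zero>) = (\<lambda>\<alpha>. \<zero> \<otimes> bd n (\<lambda>\<alpha>. \<zero>) \<alpha>)"
      by (rule bd_smult) (auto simp: carrier_chains)
    moreover have "bd n (\<lambda>\<alpha>. \<zero>) \<alpha> \<in> carrier R" for \<alpha>
      using bd_closed[of "\<lambda>\<alpha>. \<zero>" n] by (auto simp: carrier_chains)
    ultimately show "\<zero>\<^bsub>chains n\<^esub> \<in> cycles n" by (auto simp: cycles_eq carrier_chains)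
  next
    fix x y assume "x \<in> cycles n" "y \<in> cycles n"
    then show "x \<oplus>\<^bsub>chains n\<^esub> y \<in> cycles n"
      using bd_add[of x n y] C.M.add.m_closed[of x y] by (simp add: cycles_eq)
  next
    fix r x assume "r \<in> carrier R" "x \<in> cycles n"
    then show "r \<odot>\<^bsub>chains n\<^esub> x \<in> cycles n"
      using bd_smult[of x n r] C.smult_closed[of r x] by (simp add: cycles_eq)
  qed (auto simp: cycles_eq)
qed

lemma boundaries_subset_cycles: "boundaries n \<subseteq> cycles n"
  using bd_closed[of _ "n + 1"] bd_bd[of _ "n + 1"] by (auto simp: weighted_boundaries_def cycles_eq)

lemma submodule_boundaries: "submodule (boundaries n) R (chains n)"
proof -
  interpret C: module R "chains n" by (rule chains_is_module)
  interpret D: module R "chains (n + 1)" by (rule chains_is_module)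
  show ?thesis
  proof (rule C.submodule_of_lin_closed)
    show "boundaries n \<subseteq> carrier (chains n)"
      using boundaries_subset_cycles by (auto simp: cycles_eq)
    have "\<zero>\<^bsub>chains (n + 1)\<^esub> \<in> cycles (n + 1)"
      using subgroup.one_closed[OF submodule.axioms(1)[OF submodule_cycles]] by simp
    then show "\<zero>\<^bsub>chains n\<^esub> \<in> boundaries n"
      unfolding weighted_boundaries_def by (auto simp: cycles_eq intro!: image_eqI)
  next
    fix x y assume "x \<in> boundaries n" "y \<in> boundaries n"
    then obtain c d where cd: "c \<in> carrier (chains (n + 1))" "x = bd (n + 1) c"
      "d \<in> carrier (chains (n + 1))" "y = bd (n + 1) d"
      by (auto simp: weighted_boundaries_def)
    then have "bd (n + 1) (c \<oplus>\<^bsub>chains (n + 1)\<^esub> d) \<in> boundaries n"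
      unfolding weighted_boundaries_def by (intro imageI D.M.add.m_closed)
    then show "x \<oplus>\<^bsub>chains n\<^esub> y \<in> boundaries n" using bd_add cd by simp
  next
    fix r x assume r: "r \<in> carrier R" and "x \<in> boundaries n"
    then obtain c where c: "c \<in> carrier (chains (n + 1))" "x = bd (n + 1) c"
      by (auto simp: weighted_boundaries_def)
    then have "bd (n + 1) (r \<odot>\<^bsub>chains (n + 1)\<^esub> c) \<in> boundaries n"
      using r unfolding weighted_boundaries_def by (intro imageI D.smult_closed)
    then show "r \<odot>\<^bsub>chains n\<^esub> x \<in> boundaries n" using bd_smult c r by simp
  qed
qed

end


section \<open>Elementary collapses\<close>

text \<open>Here \<phi> is the free face called \<sigma> in the theorem; the common weight
  \<open>a\<close> appears as \<open>w \<tau>\<close>.\<close>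

locale weighted_collapse = weighted_complex R K w
  for R (structure) and K :: "'v::linorder set set" and w +
  fixes \<phi> \<tau> :: "'v set" and n :: int
  assumes n: "n \<ge> 1"
    and dim_\<phi>: "simplex_dim \<phi> = n - 1" and dim_\<tau>: "simplex_dim \<tau> = n"
    and free: "free_face K \<phi> \<tau>"
    and weight_eq: "w \<phi> = w \<tau>" and weight_nonzero: "w \<tau> \<noteq> \<zero>"
begin

lemma faces: "\<phi> \<in> simplices (n - 1)" "\<tau> \<in> simplices n" "\<phi> \<subset> \<tau>"
  using free dim_\<phi> dim_\<tau> weight_eq weight_nonzero
  by (auto simp: weighted_simplices_def free_face_def)

lemma coface_eq: "\<lbrakk>\<alpha> \<in> K; \<phi> \<subset> \<alpha>\<rbrakk> \<Longrightarrow> \<alpha> = \<tau>"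
  using free by (auto simp: free_face_def)

definition L where "L = K - {\<phi>, \<tau>}"

lemma weighted_complex_L: "weighted_complex R L w"
proof -
  have sub: "\<rho> \<in> L" if "\<alpha> \<in> L" "\<rho> \<subseteq> \<alpha>" "\<rho> \<noteq> {}" for \<alpha> \<rho>
  proof -
    have "\<rho> \<in> K"
      using wsc that unfolding weighted_simplicial_complex_def abstract_simplicial_complex_def L_def
      by blast
    \<comment> \<open>The simplices of \<open>K\<close> containing \<phi> are \<phi> and \<tau>,
      both removed. So a face of a simplex of \<open>L\<close> can be neither of them.\<close>
    moreover have "\<not> \<phi> \<subseteq> \<alpha>" using coface_eq[of \<alpha>] that(1) by (auto simp: L_def)
    ultimately show ?thesis using that faces(3) by (auto simp: L_def)
  qed
  have LK: "L \<subseteq> K" by (auto simp: L_def)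
  have "finite K" using wsc by (simp add: weighted_simplicial_complex_def abstract_simplicial_complex_def)
  then have "finite L" by (rule finite_subset[OF LK])
  moreover have "finite \<alpha> \<and> \<alpha> \<noteq> {}" if "\<alpha> \<in> L" for \<alpha>
    using finite_simplex simplex_nonempty subsetD[OF LK that] by simp
  ultimately have "abstract_simplicial_complex L"
    using sub by (simp add: abstract_simplicial_complex_def)
  moreover have "w \<in> L \<rightarrow> carrier R"
    using weight_closed[OF subsetD[OF LK]] by (rule Pi_I)
  moreover have "w \<rho> divides w \<alpha>" if "\<rho> \<in> L" "\<alpha> \<in> L" "\<rho> \<subseteq> \<alpha>" for \<rho> \<alpha>
    using weight_divides[OF subsetD[OF LK that(2)] subsetD[OF LK that(1)] that(3)] .
  ultimately have "weighted_simplicial_complex R L w"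
    by (simp add: weighted_simplicial_complex_def)
  then show ?thesis by (intro weighted_complex.intro domain_axioms weighted_complex_axioms.intro)
qed

sublocale L: weighted_complex R L w by (rule weighted_complex_L)

lemma carrier_chains_L:
  "carrier (L.chains i) = {c \<in> carrier (chains i). c \<phi> = \<zero> \<and> c \<tau> = \<zero>}"
proof -
  have "L.simplices i = simplices i - {\<phi>, \<tau>}" by (auto simp: weighted_simplices_def L_def)
  then show ?thesis by (auto simp: L.carrier_chains carrier_chains)
qed

lemma chain_eq_zero:
  assumes "c \<in> carrier (chains i)"
  shows "i \<noteq> n - 1 \<Longrightarrow> c \<phi> = \<zero>" "i \<noteq> n \<Longrightarrow> c \<tau> = \<zero>"
  using assms simplicesD(3)[OF faces(1)] simplicesD(3)[OF faces(2)] simplicesD(3)[of _ i]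
  by (fastforce simp: carrier_chains)+

text \<open>Incidence numbers do not see the complex, and the summands present only for
  \<open>K\<close> belong to simplices where \<open>c\<close> vanishes.\<close>

lemma bd_L:
  assumes c: "c \<in> carrier (L.chains i)"
  shows "L.bd i c = bd i c"
proof (cases "i \<ge> 1")
  case True
  have cK: "c \<in> carrier (chains i)" using c carrier_chains_L by blast
  have "c \<alpha> \<otimes> incidence R w \<alpha> \<rho> \<in> carrier R" if "\<alpha> \<in> simplices i" for \<alpha> \<rho>
    using cK incidence_closed[OF that True] by (auto simp: carrier_chains)
  moreover have "c \<alpha> \<otimes> incidence R w \<alpha> \<rho> = \<zero>" if "\<alpha> \<in> simplices i - L.simplices i" for \<alpha> \<rho>
    using c that incidence_closed[OF _ True] by (auto simp: L.carrier_chains)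
  moreover have "L.simplices i \<subseteq> simplices i" by (auto simp: weighted_simplices_def L_def)
  ultimately have "(\<Oplus>\<alpha>\<in>L.simplices i. c \<alpha> \<otimes> incidence R w \<alpha> \<rho>) =
      (\<Oplus>\<alpha>\<in>simplices i. c \<alpha> \<otimes> incidence R w \<alpha> \<rho>)" for \<rho>
    using finite_simplices by (intro add.finprod_mono_neutral_cong_left) auto
  then show ?thesis
    by (simp add: fun_eq_iff bd_eq_sum_incidence[OF cK True] L.bd_eq_sum_incidence[OF c True])
qed (simp add: bd_nonpos L.bd_nonpos)

definition \<epsilon> where "\<epsilon> = incidence R w \<tau> \<phi>"

text \<open>Equal nonzero weights have quotient 1, so \<open>\<epsilon>\<close> is a power of -1 and
  thus its own inverse.\<close>

lemma \<epsilon>_unit: "\<epsilon> \<in> carrier R" "\<epsilon> \<otimes> \<epsilon> = \<one>"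
proof -
  note \<tau> = simplicesD[OF faces(2)]
  have "card (\<tau> - \<phi>) = 1"
    using faces(3) \<tau>(2,3) simplicesD(2,3)[OF faces(1)] by (subst card_Diff_subset) auto
  then obtain x where x: "\<tau> - \<phi> = {x}" by (auto simp: card_1_singleton_iff)
  then have \<phi>: "x \<in> \<tau>" "\<phi> = \<tau> - {x}" using faces(3) by auto
  have "exact_quotient R (w \<tau>) (w \<phi>) = \<one>"
    using weight_closed[OF \<tau>(1)] \<tau>(4) weight_eq by (intro exact_quotient_eq) auto
  moreover define k where "k = card {y\<in>\<tau>. y < x}"
  ultimately have k: "\<epsilon> = (\<ominus> \<one>) [^] k"
    using incidence_remove[OF \<phi>(1), of R w, folded \<phi>(2)] by (simp add: \<epsilon>_def)
  then show "\<epsilon> \<in> carrier R" by simp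
  have "(\<ominus> \<one>) [^] k \<otimes> (\<ominus> \<one>) [^] k = (\<ominus> \<one> \<otimes> \<ominus> \<one>) [^] k"
    by (simp add: nat_pow_distrib)
  also have "\<dots> = \<one>" by (simp add: l_minus)
  finally show "\<epsilon> \<otimes> \<epsilon> = \<one>" using k by simp
qed

text \<open>Freeness of \<phi> says that row \<phi> of the boundary matrix has its only nonzero
  entry in column \<tau>.\<close>

lemma bd_at_free_face:
  assumes c: "c \<in> carrier (chains n)"
  shows "bd n c \<phi> = c \<tau> \<otimes> \<epsilon>"
proof -
  have "incidence R w \<alpha> \<phi> = \<zero>" if "\<alpha> \<in> simplices n" "\<alpha> \<noteq> \<tau>" for \<alpha>
    using incidence_nonzeroD[of R w \<alpha> \<phi>] coface_eq[OF simplicesD(1)[OF that(1)]] that(2) by auto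
  then have "(\<Oplus>\<alpha>\<in>simplices n. c \<alpha> \<otimes> incidence R w \<alpha> \<phi>) =
      (\<Oplus>\<alpha>\<in>{\<tau>}. c \<alpha> \<otimes> incidence R w \<alpha> \<phi>)"
    using c faces(2) incidence_closed n finite_simplices
    by (intro add.finprod_mono_neutral_cong_right) (auto simp: carrier_chains)
  also have "\<dots> = c \<tau> \<otimes> \<epsilon>"
    using c \<epsilon>_unit(1) by (simp add: carrier_chains \<epsilon>_def finsum_insert)
  finally show ?thesis using bd_eq_sum_incidence[OF c n] by simp
qed

text \<open>The boundary at \<phi> is the coefficient at \<tau> times the unit
  \<open>\<epsilon>\<close>, so that coefficient vanishes. The coefficient at \<phi> is zero because
  \<phi> has the wrong dimension.\<close>

lemma chain_in_L_of_bd: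
  assumes c: "c \<in> carrier (chains n)" and "bd n c \<phi> = \<zero>"
  shows "c \<in> carrier (L.chains n)"
proof -
  have carr: "c \<tau> \<in> carrier R" using c by (auto simp: carrier_chains)
  have "c \<tau> = (c \<tau> \<otimes> \<epsilon>) \<otimes> \<epsilon>" using \<epsilon>_unit carr by (simp add: m_assoc)
  also have "\<dots> = \<zero>" using assms bd_at_free_face[OF c] \<epsilon>_unit(1) by simp
  finally show ?thesis using c chain_eq_zero(1)[OF c] by (simp add: carrier_chains_L)
qed

text \<open>\<open>\<partial>\<tau>\<close> has coefficient \<open>\<epsilon>\<close> at \<open>\<phi>\<close>, so subtracting \<open>\<epsilon> c(\<phi>) \<partial>\<tau>\<close> from \<open>c\<close> removes \<open>\<phi>\<close>.\<close>

lemma chain_split: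
  assumes c: "c \<in> carrier (chains (n - 1))"
  obtains b c' where "b \<in> boundaries (n - 1)" "c' \<in> carrier (L.chains (n - 1))"
    "c = (\<lambda>\<alpha>. b \<alpha> \<oplus> c' \<alpha>)"
proof -
  interpret C: module R "chains (n - 1)" by (rule chains_is_module)
  interpret D: module R "chains n" by (rule chains_is_module)
  have carr: "c \<alpha> \<in> carrier R" for \<alpha> using c by (auto simp: carrier_chains)
  define d where "d = (\<lambda>\<alpha>. (c \<phi> \<otimes> \<epsilon>) \<otimes> basis_vector R \<tau> \<alpha>)"
  have d: "d \<in> carrier (chains n)"
    using carr \<epsilon>_unit(1) faces(2) by (auto simp: carrier_chains d_def basis_vector_def)
  define b where "b = bd n d"
  have b: "b \<in> carrier (chains (n - 1))" unfolding b_def by (rule bd_closed[OF d])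
  then have b_carr: "b \<alpha> \<in> carrier R" for \<alpha> by (auto simp: carrier_chains)
  have b\<phi>: "b \<phi> = c \<phi>"
    using bd_at_free_face[OF d] \<epsilon>_unit carr by (simp add: b_def d_def basis_vector_def m_assoc)
  define c' where "c' = (\<lambda>\<alpha>. c \<alpha> \<ominus> b \<alpha>)"
  show thesis
  proof
    show "b \<in> boundaries (n - 1)" using d by (auto simp: weighted_boundaries_def b_def)
    have "c' \<in> carrier (chains (n - 1))"
      using c b by (auto simp: carrier_chains c'_def minus_eq)
    \<comment> \<open>At \<phi> the subtraction gives zero; at \<tau> the chain vanishes for reasons
      of dimension.\<close>
    then show "c' \<in> carrier (L.chains (n - 1))"
      using chain_eq_zero(2)[of c' "n - 1"] b\<phi> carr
      by (simp add: carrier_chains_L c'_def minus_eq r_neg)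
    show "c = (\<lambda>\<alpha>. b \<alpha> \<oplus> c' \<alpha>)"
      using carr b_carr by (simp add: fun_eq_iff c'_def minus_eq a_lcomm[of "b _"] r_neg)
  qed
qed

section \<open>Comparison of cycles, boundaries and homology of \<open>K\<close> and
  \<open>L\<close>\<close>

lemma cycles_L: "L.cycles i = cycles i \<inter> carrier (L.chains i)"
  using bd_L[of _ i] carrier_chains_L[of i] by (auto simp: cycles_eq L.cycles_eq)

lemma carrier_chains_L_eq:
  assumes "i \<noteq> n - 1" "i \<noteq> n"
  shows "carrier (L.chains i) = carrier (chains i)"
  using chain_eq_zero[of _ i] assms by (auto simp: carrier_chains_L)

text \<open>In degree \<open>n - 1\<close> the part at \<phi> is split off as a boundary. In every
  other degree \<open>z\<close> already lies in \<open>L\<close>, and \<open>b\<close> can be taken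
  to be zero: in degree \<open>n\<close> because its boundary vanishes at \<phi>, elsewhere because
  the chains agree.\<close>

lemma cycle_split:
  assumes z: "z \<in> cycles i"
  shows "\<exists>b\<in>boundaries i. \<exists>z'\<in>L.cycles i. z = b \<oplus>\<^bsub>chains i\<^esub> z'"
proof (cases "i = n - 1")
  case True
  have "z \<in> carrier (chains (n - 1))" using z True by (simp add: cycles_eq)
  then obtain b z' where bz: "b \<in> boundaries i" "z' \<in> carrier (L.chains i)"
    "z = (\<lambda>\<alpha>. b \<alpha> \<oplus> z' \<alpha>)" using chain_split True by metis
  have z': "z' \<in> carrier (chains i)" using bz(2) carrier_chains_L by blast
  have b: "b \<in> carrier (chains i)" "bd i b = (\<lambda>\<alpha>. \<zero>)"
    using bz(1) boundaries_subset_cycles[of i] by (auto simp: cycles_eq)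
  have "bd i z' \<alpha> \<in> carrier R" for \<alpha> using bd_closed[OF z'] by (auto simp: carrier_chains)
  \<comment> \<open>The split-off \<open>b\<close> is a boundary, hence a cycle, so
    \<open>z'\<close> inherits the cycle property from \<open>z\<close>.\<close>
  then have "bd i z' = bd i z" using bd_add[OF b(1) z'] bz(3) b(2) by simp
  then have "z' \<in> L.cycles i" using z z' bz(2) by (simp add: cycles_L cycles_eq)
  then show ?thesis using bz by auto
next
  case False
  have zc: "z \<in> carrier (chains i)" and bz: "bd i z = (\<lambda>\<alpha>. \<zero>)" using z by (auto simp: cycles_eq)
  have "z \<in> carrier (L.chains i)"
    using chain_in_L_of_bd[of z] carrier_chains_L_eq[OF False] zc bz by (cases "i = n") auto
  then have "z \<in> L.cycles i" using z by (simp add: cycles_L)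
  moreover have "(\<lambda>\<alpha>. \<zero>) \<in> boundaries i"
    using subgroup.one_closed[OF submodule.axioms(1)[OF submodule_boundaries[of i]]] by simp
  moreover have "z = (\<lambda>\<alpha>. \<zero>) \<oplus>\<^bsub>chains i\<^esub> z" using zc by (auto simp: carrier_chains)
  ultimately show ?thesis by blast
qed

text \<open>The point is to replace a chain \<open>c\<close> of \<open>K\<close> bounding
  \<open>b\<close> by one of \<open>L\<close>. The cases concern the degree \<open>i + 1\<close> of
  \<open>c\<close>: in degree \<open>n - 1\<close> a boundary is split off, which does not change
  the boundary of \<open>c\<close>; in degree \<open>n\<close> the chain \<open>c\<close> lies in
  \<open>L\<close> already, since \<open>b\<close> vanishes at \<phi>; in other degrees the chains
  agree.\<close>

lemma boundaries_L: "L.boundaries i = L.cycles i \<inter> boundaries i"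
proof (intro equalityI subsetI)
  fix b assume b: "b \<in> L.boundaries i"
  then obtain c where "c \<in> carrier (L.chains (i + 1))" "b = L.bd (i + 1) c"
    by (auto simp: weighted_boundaries_def)
  then have "b \<in> boundaries i"
    using bd_L carrier_chains_L by (auto simp: weighted_boundaries_def)
  then show "b \<in> L.cycles i \<inter> boundaries i" using L.boundaries_subset_cycles b by blast
next
  fix b assume b: "b \<in> L.cycles i \<inter> boundaries i"
  then obtain c where c: "c \<in> carrier (chains (i + 1))" "b = bd (i + 1) c"
    by (auto simp: weighted_boundaries_def)
  have "\<exists>c'\<in>carrier (L.chains (i + 1)). bd (i + 1) c' = b"
  proof (cases "i + 1 = n - 1")
    case True
    then obtain d c' where dc: "d \<in> boundaries (i + 1)" "c' \<in> carrier (L.chains (i + 1))"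
      "c = (\<lambda>\<alpha>. d \<alpha> \<oplus> c' \<alpha>)" using chain_split[of c] c(1) by metis
    have c': "c' \<in> carrier (chains (i + 1))" using dc(2) carrier_chains_L by blast
    have d: "d \<in> carrier (chains (i + 1))" "bd (i + 1) d = (\<lambda>\<alpha>. \<zero>)"
      using dc(1) boundaries_subset_cycles[of "i + 1"] by (auto simp: cycles_eq)
    have "bd (i + 1) c' \<alpha> \<in> carrier R" for \<alpha>
      using bd_closed[OF c'] by (auto simp: carrier_chains)
    then have "bd (i + 1) c' = b" using bd_add[OF d(1) c'] dc(3) d(2) c(2) by simp
    then show ?thesis using dc(2) by blast
  next
    case False
    have "b \<phi> = \<zero>" using b by (auto simp: L.cycles_eq carrier_chains_L)
    then have "c \<in> carrier (L.chains (i + 1))"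
      using chain_in_L_of_bd[of c] carrier_chains_L_eq[OF False] c by (cases "i + 1 = n") auto
    then show ?thesis using c by blast
  qed
  then show "b \<in> L.boundaries i" using bd_L by (auto simp: weighted_boundaries_def intro!: image_eqI)
qed

lemma homology_L:
  "module_isomorphic R (weighted_homology R K w i) (weighted_homology R L w i)"
proof -
  interpret C: module R "chains i" by (rule chains_is_module)
  \<comment> \<open>The chain modules of \<open>K\<close> and \<open>L\<close> share all operations
    and can differ only in the carrier. This places both homologies inside \<open>chains i\<close>,
    where the isomorphism theorem applies with \<open>B\<close> the boundaries of \<open>K\<close>
    and \<open>Z'\<close> the cycles of \<open>L\<close>.\<close>
  have L_upd: "(L.chains i)\<lparr>carrier := Y\<rparr> = (chains i)\<lparr>carrier := Y\<rparr>" for Y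
    by (simp add: weighted_chains_def free_module_def)
  have "submodule (L.cycles i) R (chains i)"
  proof (rule C.submodule_of_lin_closed)
    show "L.cycles i \<subseteq> carrier (chains i)" by (auto simp: cycles_L cycles_eq)
    show "\<zero>\<^bsub>chains i\<^esub> \<in> L.cycles i"
      using subgroup.one_closed[OF submodule.axioms(1)[OF L.submodule_cycles[of i]]] by simp
  next
    interpret D: module R "L.chains i" by (rule L.chains_is_module)
    show "x \<oplus>\<^bsub>chains i\<^esub> y \<in> L.cycles i" if "x \<in> L.cycles i" "y \<in> L.cycles i" for x y
      using D.submoduleE(5)[OF L.submodule_cycles that] by simp
    show "r \<odot>\<^bsub>chains i\<^esub> x \<in> L.cycles i" if "r \<in> carrier R" "x \<in> L.cycles i" for r x
      using D.submoduleE(4)[OF L.submodule_cycles that] by simp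
  qed
  from C.quotient_module_isomorphic_Int[OF submodule_boundaries this, of "cycles i"]
  show ?thesis
    unfolding weighted_homology_def L_upd boundaries_L using cycle_split
    by (auto simp: cycles_L)
qed

end

theorem theorem3p7:
  fixes R :: "('r, 'm) ring_scheme" (structure)
    and K L :: "'v::linorder set set"
    and w :: "'v set \<Rightarrow> 'r"
    and n :: int
    and \<sigma> \<tau> :: "'v set"
    and a :: 'r
  assumes "domain R"
    and "weighted_simplicial_complex R K w"
    and "n \<ge> 1"
    and "simplex_dim \<sigma> = n - 1"
    and "simplex_dim \<tau> = n"
    and "free_face K \<sigma> \<tau>"
    and "L = K - {\<sigma>, \<tau>}"
    and "a \<in> carrier R - {\<zero>}"
    and "w \<sigma> = a"
    and "w \<tau> = a"
  shows "\<forall>i\<ge>0. module_isomorphic R (weighted_homology R K w i) (weighted_homology R L w i)"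
proof -
  interpret weighted_collapse R K w \<sigma> \<tau> n
    by (intro weighted_collapse.intro weighted_complex.intro weighted_complex_axioms.intro
        weighted_collapse_axioms.intro) (use assms in auto)
  show ?thesis using homology_L assms(7) by (simp add: L_def)
qed

end
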